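(* Assume $\mathcal Q_\Lambda^{\mathrm{cl}}\neq\{0\}$, gauge compatibility and the kernel-free condition for the clean detector (defined in the context). Assume moreover: (Transfer comparison) there are constants $0\le\varepsilon_G<1$, $\delta_G\ge0$ and a functional $\mathsf{Err}_\Lambda^{\mathrm{loc}}:\mathcal K_\Lambda^{\mathrm{loc}}\to[0,\infty)$ such that every $\mathfrak D\in\mathcal K_\Lambda^{\mathrm{loc}}$ satisfies $$\operatorname{dist}_{\mathrm{cl}}(\Theta_\Lambda\mathfrak D,\Gamma_\Lambda^{\mathrm{cl}})\ge(1-\varepsilon_G)\operatorname{dist}_{\mathrm{loc}}(\mathfrak D,\Gamma_\Lambda^{\mathrm{loc}})-\delta_G,\qquad \mathcal M_\Lambda^{\mathrm{loc}}(\mathfrak D)+\mathsf{Err}_\Lambda^{\mathrm{loc}}(\mathfrak D)\ge\mathcal M_\Lambda^{\mathrm{comp}}(\Theta_\Lambda\mathfrak D);$$ (Residual budget) there are constants $\eta_\Lambda,\Delta_\Lambda\ge0$ such that $\mathsf{Err}_\Lambda^{\mathrm{loc}}(\mathfrak D)\le\eta_\Lambda\operatorname{dist}_{\mathrm{loc}}(\mathfrak D,\Gamma_\Lambda^{\mathrm{loc}})+\Delta_\Lambda$ for every $\mathfrak D\in\mathcal K_\Lambda^{\mathrm{loc}}$. Then every $\mathfrak D\in\mathcal K_\Lambda^{\mathrm{loc}}$ satisfies $$\mathcal M_\Lambda^{\mathrm{loc}}(\mathfrak D)\ge\big(\mu_\Lambda^{\mathrm{comp}}(1-\varepsilon_G)-\eta_\Lambda\big)\operatorname{dist}_{\mathrm{loc}}(\mathfrak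 D,\Gamma_\Lambda^{\mathrm{loc}})-\mu_\Lambda^{\mathrm{comp}}\delta_G-\Delta_\Lambda.$$ In particular, if $\eta_\Lambda<\mu_\Lambda^{\mathrm{comp}}(1-\varepsilon_G)$, then the coefficient of $\operatorname{dist}_{\mathrm{loc}}$ is positive, so the localized detector $\mathcal M_\Lambda^{\mathrm{loc}}$ controls the localized quotient distance up to the additive loss $\mu_\Lambda^{\mathrm{comp}}\delta_G+\Delta_\Lambda$.
   Context: Clean setting. Let $\Lambda=\{k_0,\dots,k_0+L\}$ be a finite set of consecutive integers, $\Lambda_{\mathrm{adj}}=\{k\in\Lambda: k+1\in\Lambda\}$. For $k\in\Lambda$ let $\mathcal D_k^{\mathrm{cl}}$ be a finite-dimensional real normed space with norm $\|\cdot\|_{\mathrm{cl},k}$; $\mathcal D_\Lambda^{\mathrm{cl}}=\prod_{k}\mathcal D_k^{\mathrm{cl}}$ carries a fixed norm $\|\cdot\|_{\mathrm{cl}}$, and $\mathcal K_\Lambda^{\mathrm{cl}}\subset\mathcal D_\Lambda^{\mathrm{cl}}$ is a linear subspace. $G_\Lambda^{\mathrm{cl}}:\mathcal C_\Lambda^{\mathrm{cl}}\to\mathcal D_\Lambda^{\mathrm{cl}}$ is linear from a finite-dimensional real normed space, $\Gamma_\Lambda^{\mathrm{cl}}=\mathcal K_\Lambda^{\mathrm{cl}}\cap\operatorname{Im}G_\Lambda^{\mathrm{cl}}$, $\operatorname{dist}_{\mathrm{cl}}(d,\Gamma_\Lambda^{\mathrm{cl}})=\inf_{\gamma\in\Gamma_\Lambda^{\mathrm{cl}}}\|d-\gamma\|_{\mathrm{cl}}$,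 which is the quotient norm on $\mathcal Q_\Lambda^{\mathrm{cl}}=\mathcal K_\Lambda^{\mathrm{cl}}/\Gamma_\Lambda^{\mathrm{cl}}$; $S_\Lambda^{\mathrm{cl}}$ is its unit sphere. $O_\Lambda^{\mathrm{cl}}$ is a linear map from $\mathcal K_\Lambda^{\mathrm{cl}}$ to a finite product of finite-dimensional normed spaces (with a fixed norm). For fixed linear $R_k^{\mathrm{cl}}:\mathcal D_k^{\mathrm{cl}}\to\mathcal D_{k+1}^{\mathrm{cl}}$, $\operatorname{Rep}_\Lambda^{\mathrm{cl}}(d)=\big(\sum_{k\in\Lambda_{\mathrm{adj}}}\|d_{k+1}-R_k^{\mathrm{cl}}d_k\|_{\mathrm{cl},k+1}^2\big)^{1/2}$. $\operatorname{Tax}_\Lambda^{\mathrm{cl}}:\mathcal K_\Lambda^{\mathrm{cl}}\to[0,\infty)$ is continuous with $\operatorname{Tax}_\Lambda^{\mathrm{cl}}(\lambda d)=|\lambda|\operatorname{Tax}_\Lambda^{\mathrm{cl}}(d)$. For fixed $C_R,C_T>0$, $\mathcal M_\Lambda^{\mathrm{comp}}(d)=\|O_\Lambda^{\mathrm{cl}}d\|+C_R\operatorname{Rep}_\Lambda^{\mathrm{cl}}(d)+C_T\operatorname{Tax}_\Lambda^{\mathrm{cl}}(d)$. Gauge compatibility: $O_\Lambda^{\mathrm{cl}}$, $\operatorname{Rep}_\Lambda^{\mathrm{cl}}$, $\operatorname{Tax}_\Lambda^{\mathrm{cl}}$ are each unchanged when $d\in\mathcal K_\Lambda^{\mathrm{cl}}$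 is replaced by $d+\gamma$, $\gamma\in\Gamma_\Lambda^{\mathrm{cl}}$. Kernel-free condition: if $d\in\mathcal K_\Lambda^{\mathrm{cl}}$ and $O_\Lambda^{\mathrm{cl}}d=0$, $\operatorname{Rep}_\Lambda^{\mathrm{cl}}(d)=0$, $\operatorname{Tax}_\Lambda^{\mathrm{cl}}(d)=0$, then $d\in\Gamma_\Lambda^{\mathrm{cl}}$. Under gauge compatibility $\mathcal M_\Lambda^{\mathrm{comp}}$ descends to $\overline{\mathcal M}_\Lambda^{\mathrm{comp}}$ on $\mathcal Q_\Lambda^{\mathrm{cl}}$, and $\mu_\Lambda^{\mathrm{comp}}=\inf_{q\in S_\Lambda^{\mathrm{cl}}}\overline{\mathcal M}_\Lambda^{\mathrm{comp}}(q)$. Localized setting. $\mathcal K_\Lambda^{\mathrm{loc}}$ is a finite-dimensional space with norm $\|\cdot\|_{\mathrm{loc}}$ and a linear (gauge) subspace $\Gamma_\Lambda^{\mathrm{loc}}$; $\operatorname{dist}_{\mathrm{loc}}(\mathfrak D,\Gamma_\Lambda^{\mathrm{loc}})=\inf_{\gamma\in\Gamma_\Lambda^{\mathrm{loc}}}\|\mathfrak D-\gamma\|_{\mathrm{loc}}$; $\Theta_\Lambda:\mathcal K_\Lambda^{\mathrm{loc}}\to\mathcal K_\Lambda^{\mathrm{cl}}$ is a map (the local-to-clean chart) and $\mathcal M_\Lambda^{\mathrm{loc}}:\mathcal K_\Lambda^{\mathrm{loc}}\to[0,\infty)$ is a function (the localized detector size). *)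

theory Defs
  imports "HOL-Analysis.Analysis" "HOL-Library.Function_Algebras"
begin

text \<open>
  The spaces indexed by a scale or by an output component vary with the index. They are
  subspaces of one ambient real vector space, each with its own norm, given as a real-valued
  function that is constrained on the subspace only. Elements of a product are families of
  vectors, with pointwise operations.
\<close>

instantiation "fun" :: (type, real_vector) real_vector
begin

definition scaleR_fun :: "real \<Rightarrow> ('a \<Rightarrow> 'b) \<Rightarrow> 'a \<Rightarrow> 'b"
  where "scaleR_fun c f = (\<lambda>i. c *\<^sub>R f i)"

instance
  by standard (simp_all add: scaleR_fun_def fun_eq_iff scaleR_add_right scaleR_add_left)

end

definition fin_dim :: "'a::real_vector set \<Rightarrow> bool"
  where "fin_dim V \<longleftrightarrow> (\<exists>B. finite B \<and> V \<subseteq> span B)"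

definition norm_on :: "'a::real_vector set \<Rightarrow> ('a \<Rightarrow> real) \<Rightarrow> bool"
  where "norm_on V n \<longleftrightarrow>
    (\<forall>x\<in>V. 0 \<le> n x \<and> (n x = 0 \<longleftrightarrow> x = 0)) \<and>
    (\<forall>c. \<forall>x\<in>V. n (c *\<^sub>R x) = \<bar>c\<bar> * n x) \<and>
    (\<forall>x\<in>V. \<forall>y\<in>V. n (x + y) \<le> n x + n y)"

definition fd_normed_space :: "'a::real_vector set \<Rightarrow> ('a \<Rightarrow> real) \<Rightarrow> bool"
  where "fd_normed_space V n \<longleftrightarrow> subspace V \<and> fin_dim V \<and> norm_on V n"

definition linear_on :: "'a::real_vector set \<Rightarrow> 'b::real_vector set \<Rightarrow> ('a \<Rightarrow> 'b) \<Rightarrow> bool"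
  where "linear_on V W f \<longleftrightarrow> f ` V \<subseteq> W \<and>
    (\<forall>x\<in>V. \<forall>y\<in>V. f (x + y) = f x + f y) \<and>
    (\<forall>c. \<forall>x\<in>V. f (c *\<^sub>R x) = c *\<^sub>R f x)"

text \<open>
  The value 0 off the index set (instead of \<^const>\<open>undefined\<close>, as in \<^const>\<open>PiE\<close>) makes the
  product a subspace of the function space.
\<close>

definition prod_space :: "'i set \<Rightarrow> ('i \<Rightarrow> 'a::real_vector set) \<Rightarrow> ('i \<Rightarrow> 'a) set"
  where "prod_space I V = {d. (\<forall>i\<in>I. d i \<in> V i) \<and> (\<forall>i. i \<notin> I \<longrightarrow> d i = 0)}"

definition dist_to :: "('a::real_vector \<Rightarrow> real) \<Rightarrow> 'a set \<Rightarrow> 'a \<Rightarrow> real"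
  where "dist_to n \<Gamma> d = (INF \<gamma>\<in>\<Gamma>. n (d - \<gamma>))"

definition quot_rel :: "'a::real_vector set \<Rightarrow> 'a set \<Rightarrow> ('a \<times> 'a) set"
  where "quot_rel K \<Gamma> = {(x, y). x \<in> K \<and> y \<in> K \<and> x - y \<in> \<Gamma>}"

definition quot_space :: "'a::real_vector set \<Rightarrow> 'a set \<Rightarrow> 'a set set"
  where "quot_space K \<Gamma> = K // quot_rel K \<Gamma>"

text \<open>
  The function induced on the quotient by a function that is constant on cosets; it is meaningful
  only for such functions.
\<close>

definition descend :: "('a \<Rightarrow> 'b) \<Rightarrow> 'a set \<Rightarrow> 'b"
  where "descend f q = the_elem (f ` q)"

definition quot_norm :: "('a::real_vector \<Rightarrow> real) \<Rightarrow> 'a set \<Rightarrow> 'a set \<Rightarrow> real"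
  where "quot_norm n \<Gamma> = descend (dist_to n \<Gamma>)"

definition quot_sphere :: "'a::real_vector set \<Rightarrow> 'a set \<Rightarrow> ('a \<Rightarrow> real) \<Rightarrow> 'a set set"
  where "quot_sphere K \<Gamma> n = {q \<in> quot_space K \<Gamma>. quot_norm n \<Gamma> q = 1}"

definition sphere_inf ::
  "'a::real_vector set \<Rightarrow> 'a set \<Rightarrow> ('a \<Rightarrow> real) \<Rightarrow> ('a \<Rightarrow> real) \<Rightarrow> real"
  where "sphere_inf K \<Gamma> n M = (INF q\<in>quot_sphere K \<Gamma> n. descend M q)"

definition gauge_invariant :: "'a::real_vector set \<Rightarrow> 'a set \<Rightarrow> ('a \<Rightarrow> 'b) \<Rightarrow> bool"
  where "gauge_invariant K \<Gamma> f \<longleftrightarrow> (\<forall>d\<in>K. \<forall>\<gamma>\<in>\<Gamma>. f (d + \<gamma>) = f d)"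

definition adjacent :: "int set \<Rightarrow> int set"
  where "adjacent \<Lambda> = {k \<in> \<Lambda>. k + 1 \<in> \<Lambda>}"

definition rep_size ::
  "int set \<Rightarrow> (int \<Rightarrow> 'a::real_vector \<Rightarrow> real) \<Rightarrow> (int \<Rightarrow> 'a \<Rightarrow> 'a) \<Rightarrow> (int \<Rightarrow> 'a) \<Rightarrow> real"
  where "rep_size \<Lambda> n R d = sqrt (\<Sum>k\<in>adjacent \<Lambda>. (n (k + 1) (d (k + 1) - R k (d k)))\<^sup>2)"

lemma equiv_quot_rel:
  assumes "subspace \<Gamma>" "\<Gamma> \<subseteq> K" "subspace K"
  shows "equiv K (quot_rel K \<Gamma>)"
proof (rule equivI)
  show "refl_on K (quot_rel K \<Gamma>)"
    using assms by (auto simp: refl_on_def quot_rel_def subspace_0)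
  show "sym (quot_rel K \<Gamma>)"
    using assms subspace_neg[of \<Gamma>] by (force simp: sym_def quot_rel_def)
  show "trans (quot_rel K \<Gamma>)"
    using assms subspace_add[of \<Gamma>] by (force simp: trans_def quot_rel_def)
  show "quot_rel K \<Gamma> \<subseteq> K \<times> K"
    by (auto simp: quot_rel_def)
qed

lemma quot_rel_Image:
  assumes "subspace \<Gamma>" "\<Gamma> \<subseteq> K" "subspace K" "d \<in> K"
  shows "quot_rel K \<Gamma> `` {d} = {d + \<gamma> | \<gamma>. \<gamma> \<in> \<Gamma>}"
proof (intro set_eqI iffI)
  fix y assume "y \<in> quot_rel K \<Gamma> `` {d}"
  then have "d - y \<in> \<Gamma>" by (auto simp: quot_rel_def)
  then have "y - d \<in> \<Gamma>" using subspace_neg[OF assms(1), of "d - y"] by simp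
  then show "y \<in> {d + \<gamma> | \<gamma>. \<gamma> \<in> \<Gamma>}" by (auto intro!: exI[of _ "y - d"])
next
  fix y assume "y \<in> {d + \<gamma> | \<gamma>. \<gamma> \<in> \<Gamma>}"
  then obtain \<gamma> where g: "\<gamma> \<in> \<Gamma>" "y = d + \<gamma>" by auto
  then show "y \<in> quot_rel K \<Gamma> `` {d}"
    using assms subspace_neg[OF assms(1), of \<gamma>] by (auto simp: quot_rel_def subspace_add subsetD)
qed

lemma descend_Image:
  assumes "subspace \<Gamma>" "\<Gamma> \<subseteq> K" "subspace K" "d \<in> K" "gauge_invariant K \<Gamma> f"
  shows "descend f (quot_rel K \<Gamma> `` {d}) = f d"
proof -
  have "f ` (quot_rel K \<Gamma> `` {d}) = {f d}"
    using assms(4,5) subspace_0[OF assms(1)]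
    unfolding quot_rel_Image[OF assms(1-4)]
    by (force simp: gauge_invariant_def image_iff intro: exI[of _ 0])
  then show ?thesis by (simp add: descend_def)
qed

lemma quot_norm_Image:
  assumes "subspace \<Gamma>" "\<Gamma> \<subseteq> K" "subspace K" "d \<in> K"
  shows "quot_norm n \<Gamma> (quot_rel K \<Gamma> `` {d}) = dist_to n \<Gamma> d"
  unfolding quot_norm_def
proof (rule descend_Image[OF assms], unfold gauge_invariant_def, intro ballI)
  fix d \<gamma> assume "\<gamma> \<in> \<Gamma>"
  have "(\<lambda>\<beta>. n (d + \<gamma> - \<beta>)) ` \<Gamma> = (\<lambda>\<beta>. n (d - \<beta>)) ` \<Gamma>"
  proof (intro equalityI image_subsetI)
    fix \<beta> assume "\<beta> \<in> \<Gamma>"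
    then have "\<beta> - \<gamma> \<in> \<Gamma>" using \<open>\<gamma> \<in> \<Gamma>\<close> assms(1) by (rule subspace_diff[rotated])
    then show "n (d + \<gamma> - \<beta>) \<in> (\<lambda>\<beta>. n (d - \<beta>)) ` \<Gamma>"
      by (intro image_eqI[of _ _ "\<beta> - \<gamma>"]) (simp_all add: algebra_simps)
  next
    fix \<beta> assume "\<beta> \<in> \<Gamma>"
    then have "\<beta> + \<gamma> \<in> \<Gamma>" using \<open>\<gamma> \<in> \<Gamma>\<close> assms(1) by (simp add: subspace_add)
    then show "n (d - \<beta>) \<in> (\<lambda>\<beta>. n (d + \<gamma> - \<beta>)) ` \<Gamma>"
      by (intro image_eqI[of _ _ "\<beta> + \<gamma>"]) (simp_all add: algebra_simps)
  qed
  then show "dist_to n \<Gamma> (d + \<gamma>) = dist_to n \<Gamma> d" by (simp add: dist_to_def)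
qed

end

theory Submission
  imports Defs
begin

text \<open>
  The detector \<open>M\<close> is nonnegative, absolutely homogeneous and gauge invariant, so rescaling a
  class to the unit sphere gives \<open>\<mu> dist(d, \<Gamma>) \<le> M d\<close> on \<open>K\<close>; inserting \<open>d = \<Theta> x\<close> into the two
  transfer inequalities and the residual budget gives the estimate. Replacing \<open>dist(\<Theta> x, \<Gamma>)\<close> by
  its lower bound needs \<open>\<mu> \<ge> 0\<close>, hence a nonempty unit sphere: a finite-dimensional subspace has
  positive distance from every point outside it.
\<close>

section \<open>The distance to a subspace\<close>

lemma norm_on_subset: "norm_on V n \<Longrightarrow> W \<subseteq> V \<Longrightarrow> norm_on W n"
  by (simp add: norm_on_def subset_iff)

context
  fixes V W :: "'a::real_vector set" and n :: "'a \<Rightarrow> real"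
  assumes V: "subspace V" and n: "norm_on V n" and W: "subspace W" "W \<subseteq> V"
begin

text \<open>Since \<open>n\<close> is constrained only on \<open>V\<close>, membership of
  \<open>x - w\<close> in \<open>V\<close> comes first. The bound 0 makes the real infimum in
  \<open>dist_to\<close> a genuine lower bound.\<close>

lemma norm_on_diff_nonneg: "x \<in> V \<Longrightarrow> w \<in> W \<Longrightarrow> 0 \<le> n (x - w)"
  using V W n subspace_diff[of V x w] by (auto simp: norm_on_def)

lemma dist_to_le: "x \<in> V \<Longrightarrow> w \<in> W \<Longrightarrow> dist_to n W x \<le> n (x - w)"
  unfolding dist_to_def
  by (rule cINF_lower) (auto intro!: bdd_belowI2[of _ 0] norm_on_diff_nonneg)

lemma dist_to_greatest: "(\<And>w. w \<in> W \<Longrightarrow> c \<le> n (x - w)) \<Longrightarrow> c \<le> dist_to n W x"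
  unfolding dist_to_def using subspace_0[OF W(1)] by (intro cINF_greatest) auto

lemma dist_to_nonneg: "x \<in> V \<Longrightarrow> 0 \<le> dist_to n W x"
  by (rule dist_to_greatest) (rule norm_on_diff_nonneg)

lemma dist_to_eq_0:
  assumes "w \<in> W"
  shows "dist_to n W w = 0"
proof -
  have "w \<in> V" using assms W by blast
  moreover have "n 0 = 0" using n subspace_0[OF V] by (simp add: norm_on_def)
  ultimately show ?thesis
    using dist_to_le[of w w] dist_to_nonneg[of w] assms by simp
qed

text \<open>Competitors \<open>v\<close> for \<open>x\<close> and \<open>w\<close> for
  \<open>y\<close> add up to the competitor \<open>v + w\<close> for \<open>x + y\<close>. The
  infimum is taken over \<open>v\<close> first and over \<open>w\<close> afterwards, so no
  near-minimizers have to be chosen.\<close>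

lemma dist_to_triangle:
  assumes "x \<in> V" "y \<in> V"
  shows "dist_to n W (x + y) \<le> dist_to n W x + dist_to n W y"
proof -
  have "dist_to n W (x + y) - n (y - w) \<le> n (x - v)" if "v \<in> W" "w \<in> W" for v w
  proof -
    have "dist_to n W (x + y) \<le> n ((x + y) - (v + w))"
      using assms that V W by (intro dist_to_le subspace_add)
    also have "(x + y) - (v + w) = (x - v) + (y - w)" by simp
    also have "n \<dots> \<le> n (x - v) + n (y - w)"
    proof -
      have "x - v \<in> V" "y - w \<in> V" using that assms V W by (auto intro: subspace_diff)
      then show ?thesis using n by (simp add: norm_on_def)
    qed
    finally show ?thesis by simp
  qed
  then have "dist_to n W (x + y) - n (y - w) \<le> dist_to n W x" if "w \<in> W" for w
    using that by (intro dist_to_greatest)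
  then have "dist_to n W (x + y) - dist_to n W x \<le> dist_to n W y"
    by (intro dist_to_greatest) (simp add: algebra_simps)
  then show ?thesis by simp
qed

text \<open>A competitor \<open>w\<close> for \<open>x\<close> yields the competitor
  \<open>c *\<^sub>R w\<close> for the scaled vector; dividing by \<open>\<bar>c\<bar>\<close>
  requires the split at \<open>c = 0\<close>.\<close>

lemma dist_to_scaleR_le:
  assumes "x \<in> V"
  shows "dist_to n W (c *\<^sub>R x) \<le> \<bar>c\<bar> * dist_to n W x"
proof (cases "c = 0")
  case True
  then show ?thesis using dist_to_eq_0[OF subspace_0[OF W(1)]] by simp
next
  case False
  have "dist_to n W (c *\<^sub>R x) / \<bar>c\<bar> \<le> n (x - w)" if "w \<in> W" for w
  proof -
    have "dist_to n W (c *\<^sub>R x) \<le> n (c *\<^sub>R x - c *\<^sub>R w)"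
      using assms that V W by (intro dist_to_le subspace_scale)
    also have "\<dots> = \<bar>c\<bar> * n (x - w)"
      using n that assms V W subspace_diff[of V]
      by (auto simp: norm_on_def simp flip: scaleR_diff_right)
    finally show ?thesis using False by (simp add: field_simps)
  qed
  then have "dist_to n W (c *\<^sub>R x) / \<bar>c\<bar> \<le> dist_to n W x"
    by (rule dist_to_greatest)
  then show ?thesis using False by (simp add: field_simps)
qed

text \<open>The missing inequality is the one-sided bound for the factor \<open>inverse c\<close> at
  the vector \<open>c *\<^sub>R x\<close>.\<close>

lemma dist_to_scaleR:
  assumes "x \<in> V"
  shows "dist_to n W (c *\<^sub>R x) = \<bar>c\<bar> * dist_to n W x"
proof (cases "c = 0")
  case True
  then show ?thesis using dist_to_eq_0[OF subspace_0[OF W(1)]] by simp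
next
  case False
  have "dist_to n W (inverse c *\<^sub>R (c *\<^sub>R x)) \<le> \<bar>inverse c\<bar> * dist_to n W (c *\<^sub>R x)"
    using assms V by (intro dist_to_scaleR_le subspace_scale)
  then have "\<bar>c\<bar> * dist_to n W x \<le> dist_to n W (c *\<^sub>R x)"
    using False by (simp add: field_simps)
  then show ?thesis using dist_to_scaleR_le[OF assms, of c] by simp
qed

end

text \<open>
  In the induction step \<open>t \<mapsto> dist(x - t b, W)\<close> is Lipschitz continuous and tends to infinity
  with \<open>\<bar>t\<bar>\<close>, so a positive lower bound comes from compactness of an interval only.
\<close>

lemma dist_to_span_pos:
  assumes V: "subspace V" and n: "norm_on V n"
    and B: "finite B" "independent B" "span B \<subseteq> V" and x: "x \<in> V" "x \<notin> span B"
  shows "0 < dist_to n (span B) x"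
  using B x
proof (induction B arbitrary: x rule: finite_induct)
  case empty
  then have "0 \<le> n x" "n x \<noteq> 0" using n by (auto simp: norm_on_def)
  then show ?case by (simp add: dist_to_def)
next
  case (insert b B)
  have BV: "span B \<subseteq> V" using insert.prems(2) span_mono[of B "insert b B"] by blast
  have b: "b \<in> V" "b \<notin> span B" and ind: "independent B"
    using insert.prems(1,2) insert.hyps span_base[of b "insert b B"]
    by (auto simp: independent_insert)
  note q = V n subspace_span BV
  define q where "q = dist_to n (span B)"
  have sub: "x - t *\<^sub>R b \<in> V" for t
    using b insert.prems V by (intro subspace_diff subspace_scale)
  \<comment> \<open>If \<open>x - t *\<^sub>R b\<close> were in \<open>span B\<close>, then
    \<open>x\<close> would be in \<open>span (insert b B)\<close>; hence the induction hypothesis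
    applies.\<close>
  have pos: "0 < q (x - t *\<^sub>R b)" for t
    unfolding q_def using insert.prems(4)
    by (intro insert.IH ind BV sub) (auto simp: span_insert)
  have qb: "0 < q b"
    unfolding q_def by (intro insert.IH ind BV b)
  \<comment> \<open>Split \<open>x - s *\<^sub>R b\<close> as
    \<open>(x - t *\<^sub>R b) + (t - s) *\<^sub>R b\<close>.\<close>
  have lip: "q (x - s *\<^sub>R b) \<le> q (x - t *\<^sub>R b) + \<bar>s - t\<bar> * q b" for s t
    using dist_to_triangle[OF q sub[of t], of "(t - s) *\<^sub>R b"] dist_to_scaleR[OF q b(1), of "t - s"]
      b V by (simp add: q_def subspace_scale subspace_diff scaleR_diff_left abs_minus_commute)
  have cont: "continuous_on S (\<lambda>t. q (x - t *\<^sub>R b))" for S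
  proof (rule continuous_on_subset, rule lipschitz_on_continuous_on, rule lipschitz_onI)
    show "dist (q (x - s *\<^sub>R b)) (q (x - t *\<^sub>R b)) \<le> q b * dist s t" for s t
      using lip[of s t] lip[of t s] by (simp add: dist_real_def abs_le_iff abs_minus_commute mult.commute)
  qed (use qb in auto)
  have coercive: "\<bar>t\<bar> * q b \<le> q (x - t *\<^sub>R b) + q x" for t
  proof -
    have "t *\<^sub>R b = x + (-1) *\<^sub>R (x - t *\<^sub>R b)" by simp
    then have "q (t *\<^sub>R b) \<le> q x + q ((-1) *\<^sub>R (x - t *\<^sub>R b))"
      using dist_to_triangle[OF q insert.prems(3) subspace_scale[OF V sub[of t], of "-1"]]
      unfolding q_def by metis
    then show ?thesis
      using dist_to_scaleR[OF q sub[of t], of "-1"] dist_to_scaleR[OF q b(1), of t]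
      by (simp only: q_def)
  qed
  \<comment> \<open>For \<open>\<bar>t\<bar> > T\<close> the coercivity bound gives
    \<open>q (x - t *\<^sub>R b) \<ge> q x\<close>, so only the interval from \<open>-T\<close> to
    \<open>T\<close> remains to be minimized over.\<close>
  define T where "T = 2 * q x / q b"
  have qx: "0 < q x" using pos[of 0] by simp
  then have T: "0 \<le> T" using qb by (simp add: T_def)
  have "\<exists>s\<in>{-T..T}. \<forall>t\<in>{-T..T}. q (x - s *\<^sub>R b) \<le> q (x - t *\<^sub>R b)"
    by (rule continuous_attains_inf) (use T cont in auto)
  then obtain t0 where t0: "\<forall>t\<in>{-T..T}. q (x - t0 *\<^sub>R b) \<le> q (x - t *\<^sub>R b)"
    by blast
  define c where "c = min (q (x - t0 *\<^sub>R b)) (q x)"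
  have "c \<le> n (x - w)" if w: "w \<in> span (insert b B)" for w
  proof -
    \<comment> \<open>Subtracting \<open>t *\<^sub>R b\<close> from both \<open>x\<close> and
      \<open>w\<close> keeps their difference, and the shifted \<open>w\<close> competes in the
      distance to \<open>span B\<close>.\<close>
    obtain t where t: "w - t *\<^sub>R b \<in> span B" using w unfolding span_breakdown_eq by blast
    have "c \<le> q (x - t *\<^sub>R b)"
    proof (cases "\<bar>t\<bar> \<le> T")
      case True
      then show ?thesis using t0 by (simp add: c_def abs_le_iff min.coboundedI1)
    next
      case False
      then have "2 * q x \<le> \<bar>t\<bar> * q b" using qb by (simp add: T_def field_simps)
      then show ?thesis using coercive[of t] by (simp add: c_def)
    qed
    also have "\<dots> \<le> n (x - w)"
      using dist_to_le[OF q sub[of t] t] by (simp add: q_def)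
    finally show ?thesis .
  qed
  then have "c \<le> dist_to n (span (insert b B)) x"
    using insert.prems by (intro dist_to_greatest[OF V n subspace_span])
  moreover have "0 < c" using pos qx by (simp add: c_def)
  ultimately show ?case by simp
qed

text \<open>A basis of \<open>W\<close> is an independent subset of a finitely generated span, hence
  finite, and \<open>W\<close> is its span.\<close>

lemma dist_to_pos:
  assumes V: "subspace V" and n: "norm_on V n"
    and W: "subspace W" "W \<subseteq> V" "fin_dim W" and x: "x \<in> V" "x \<notin> W"
  shows "0 < dist_to n W x"
proof -
  obtain B where B: "B \<subseteq> W" "independent B" "W \<subseteq> span B"
    using basis_exists[of W] by metis
  have span: "span B = W" using B W(1) span_minimal by blast
  have "finite B"
    using W(3) B independent_span_bound unfolding fin_dim_def by (meson order_trans)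
  then show ?thesis
    using dist_to_span_pos[OF V n _ B(2)] W x by (simp add: span)
qed

lemma fin_dim_range:
  assumes "linear G" "fin_dim (UNIV :: 'c::real_vector set)"
  shows "fin_dim (range (G :: 'c \<Rightarrow> 'a::real_vector))"
proof -
  obtain B :: "'c set" where "finite B" "span B = UNIV"
    using assms(2) by (auto simp: fin_dim_def)
  then show ?thesis
    unfolding fin_dim_def using linear_span_image[OF assms(1), of B]
    by (intro exI[of _ "G ` B"]) simp
qed

section \<open>The infimum over the unit sphere of the quotient\<close>

context
  fixes K \<Gamma> :: "'a::real_vector set" and n M :: "'a \<Rightarrow> real"
  assumes K: "subspace K" and n: "norm_on K n" and \<Gamma>: "subspace \<Gamma>" "\<Gamma> \<subseteq> K"
    and M_gauge: "gauge_invariant K \<Gamma> M"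
    and M_nonneg: "\<And>d. d \<in> K \<Longrightarrow> 0 \<le> M d"
begin

text \<open>Representatives at distance 1 are exactly those whose cosets form the unit sphere, and
  \<open>M\<close> is constant on cosets. The infimum over classes thus becomes one over
  vectors.\<close>

lemma descend_image_quot_sphere:
  "descend M ` quot_sphere K \<Gamma> n = M ` {d \<in> K. dist_to n \<Gamma> d = 1}"
proof -
  have "quot_sphere K \<Gamma> n = (\<lambda>d. quot_rel K \<Gamma> `` {d}) ` {d \<in> K. dist_to n \<Gamma> d = 1}"
    using quot_norm_Image[OF \<Gamma> K]
    by (auto simp: quot_sphere_def quot_space_def quotient_def)
  then show ?thesis
    using descend_Image[OF \<Gamma> K _ M_gauge] by (auto simp: image_image)
qed

lemma sphere_inf_le:
  assumes "d \<in> K" "dist_to n \<Gamma> d = 1"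
  shows "sphere_inf K \<Gamma> n M \<le> M d"
  unfolding sphere_inf_def descend_image_quot_sphere
  by (rule cINF_lower) (use assms in \<open>auto intro!: bdd_belowI2[of _ 0] M_nonneg\<close>)

lemma sphere_inf_nonneg:
  assumes "fin_dim \<Gamma>" "K \<noteq> \<Gamma>"
  shows "0 \<le> sphere_inf K \<Gamma> n M"
proof -
  obtain d where d: "d \<in> K" "d \<notin> \<Gamma>" using assms(2) \<Gamma>(2) by blast
  then have "0 < dist_to n \<Gamma> d" using dist_to_pos[OF K n \<Gamma> assms(1)] by simp
  \<comment> \<open>This vector shows that the sphere is nonempty; the real infimum of the empty set
    would carry no information about its sign.\<close>
  then have "inverse (dist_to n \<Gamma> d) *\<^sub>R d \<in> {d \<in> K. dist_to n \<Gamma> d = 1}"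
    using d K dist_to_scaleR[OF K n \<Gamma> d(1)] by (simp add: subspace_scale)
  then show ?thesis
    unfolding sphere_inf_def descend_image_quot_sphere
    by (intro cINF_greatest) (auto intro: M_nonneg)
qed

lemma sphere_inf_mult_dist_to_le:
  assumes hom: "\<And>c d. d \<in> K \<Longrightarrow> M (c *\<^sub>R d) = \<bar>c\<bar> * M d" and d: "d \<in> K"
  shows "sphere_inf K \<Gamma> n M * dist_to n \<Gamma> d \<le> M d"
proof (cases "dist_to n \<Gamma> d = 0")
  \<comment> \<open>The zero class cannot be rescaled to the sphere, but there the left side
    vanishes and \<open>M d\<close> is nonnegative.\<close>
  case True
  then show ?thesis using M_nonneg[OF d] by simp
next
  case False
  then have r: "0 < dist_to n \<Gamma> d" using dist_to_nonneg[OF K n \<Gamma> d] by simp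
  have "sphere_inf K \<Gamma> n M \<le> M (inverse (dist_to n \<Gamma> d) *\<^sub>R d)"
    using r d K dist_to_scaleR[OF K n \<Gamma> d] by (intro sphere_inf_le) (simp_all add: subspace_scale)
  also have "\<dots> = M d / dist_to n \<Gamma> d" using hom[OF d] r by (simp add: field_simps)
  finally show ?thesis using r by (simp add: field_simps)
qed

end

section \<open>Triviality of the quotient, homogeneity of the detector, and the transfer
  estimate\<close>

lemma quot_space_self:
  assumes "subspace \<Gamma>"
  shows "quot_space \<Gamma> \<Gamma> = {\<Gamma>}"
proof -
  have "quot_rel \<Gamma> \<Gamma> `` {x} = \<Gamma>" if "x \<in> \<Gamma>" for x
    using that assms by (auto simp: quot_rel_def subspace_diff)
  then show ?thesis
    using subspace_0[OF assms] by (auto simp: quot_space_def quotient_def)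
qed

text \<open>Every defect lies in \<open>D (k + 1)\<close>, where \<open>n (k + 1)\<close> is
  homogeneous; squaring turns the factor into \<open>c\<^sup>2\<close>, and the root returns
  \<open>\<bar>c\<bar>\<close>.\<close>

lemma rep_size_scaleR:
  assumes D: "\<And>k. k \<in> \<Lambda> \<Longrightarrow> subspace (D k) \<and> norm_on (D k) (n k)"
    and R: "\<And>k. k \<in> adjacent \<Lambda> \<Longrightarrow> linear_on (D k) (D (k + 1)) (R k)"
    and d: "d \<in> prod_space \<Lambda> D"
  shows "rep_size \<Lambda> n R (c *\<^sub>R d) = \<bar>c\<bar> * rep_size \<Lambda> n R d"
proof -
  have "n (k + 1) ((c *\<^sub>R d) (k + 1) - R k ((c *\<^sub>R d) k)) =
      \<bar>c\<bar> * n (k + 1) (d (k + 1) - R k (d k))" if k: "k \<in> adjacent \<Lambda>" for k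
  proof -
    have mem: "k \<in> \<Lambda>" "k + 1 \<in> \<Lambda>" using k by (auto simp: adjacent_def)
    then have dk: "d k \<in> D k" "d (k + 1) \<in> D (k + 1)" using d by (auto simp: prod_space_def)
    then have "R k (d k) \<in> D (k + 1)" "R k (c *\<^sub>R d k) = c *\<^sub>R R k (d k)"
      using R[OF k] by (auto simp: linear_on_def)
    then show ?thesis
      using D[OF mem(2)] dk subspace_diff[of "D (k + 1)"]
      by (simp add: norm_on_def scaleR_fun_def flip: scaleR_diff_right)
  qed
  then have "rep_size \<Lambda> n R (c *\<^sub>R d) =
      sqrt (c\<^sup>2 * (\<Sum>k\<in>adjacent \<Lambda>. (n (k + 1) (d (k + 1) - R k (d k)))\<^sup>2))"
    unfolding rep_size_def by (simp add: power_mult_distrib sum_distrib_left)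
  then show ?thesis by (simp add: rep_size_def real_sqrt_mult)
qed

text \<open>The localized space is the whole type \<open>'l\<close>, so its quotient distance is
  \<open>infdist\<close>; \<open>\<Gamma>loc\<close> contains 0, so the default value of
  \<open>infdist\<close> at the empty set does not occur. The last conjunct expresses control by
  solving the estimate for the distance.\<close>

theorem corollary7p4:
  fixes k0 :: int and L :: nat and \<Lambda> :: "int set"
    and D :: "int \<Rightarrow> 'd::real_vector set" and nD :: "int \<Rightarrow> 'd \<Rightarrow> real"
    and ncl :: "(int \<Rightarrow> 'd) \<Rightarrow> real"
    and K \<Gamma> :: "(int \<Rightarrow> 'd) set"
    and G :: "'c::real_normed_vector \<Rightarrow> int \<Rightarrow> 'd"
    and J :: "'j set" and E :: "'j \<Rightarrow> 'e::real_vector set" and nE :: "'j \<Rightarrow> 'e \<Rightarrow> real"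
    and nO :: "('j \<Rightarrow> 'e) \<Rightarrow> real"
    and Obs :: "(int \<Rightarrow> 'd) \<Rightarrow> 'j \<Rightarrow> 'e"
    and R :: "int \<Rightarrow> 'd \<Rightarrow> 'd"
    and Rep Tax M :: "(int \<Rightarrow> 'd) \<Rightarrow> real"
    and C\<^sub>R C\<^sub>T \<mu> :: real
    and \<Gamma>loc :: "'l::real_normed_vector set"
    and \<Theta> :: "'l \<Rightarrow> int \<Rightarrow> 'd"
    and Mloc Err :: "'l \<Rightarrow> real"
    and \<epsilon> \<delta> \<eta> \<Delta> :: real
  assumes Lambda: "\<Lambda> = {k0..k0 + int L}"
    and D: "\<forall>k\<in>\<Lambda>. fd_normed_space (D k) (nD k)"
    and ncl: "norm_on (prod_space \<Lambda> D) ncl"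
    and K: "subspace K" "K \<subseteq> prod_space \<Lambda> D"
    and C: "fin_dim (UNIV :: 'c set)"
    and G: "linear G" "range G \<subseteq> prod_space \<Lambda> D"
    and Gamma: "\<Gamma> = K \<inter> range G"
    and E: "finite J" "\<forall>j\<in>J. fd_normed_space (E j) (nE j)"
    and nO: "norm_on (prod_space J E) nO"
    and Obs: "linear_on K (prod_space J E) Obs"
    and R: "\<forall>k\<in>adjacent \<Lambda>. linear_on (D k) (D (k + 1)) (R k)"
    and Rep: "Rep = rep_size \<Lambda> nD R"
    and Tax_nonneg: "\<forall>d\<in>K. 0 \<le> Tax d"
    and Tax_cont: "continuous_map (Metric_space.mtopology K (\<lambda>x y. ncl (x - y))) euclideanreal Tax"
    and Tax_hom: "\<forall>c. \<forall>d\<in>K. Tax (c *\<^sub>R d) = \<bar>c\<bar> * Tax d"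
    and C_pos: "0 < C\<^sub>R" "0 < C\<^sub>T"
    and M: "M = (\<lambda>d. nO (Obs d) + C\<^sub>R * Rep d + C\<^sub>T * Tax d)"
    and quot_nontrivial: "quot_space K \<Gamma> \<noteq> {\<Gamma>}"
    and gauge: "gauge_invariant K \<Gamma> Obs" "gauge_invariant K \<Gamma> Rep" "gauge_invariant K \<Gamma> Tax"
    and kernel_free: "\<forall>d\<in>K. Obs d = 0 \<and> Rep d = 0 \<and> Tax d = 0 \<longrightarrow> d \<in> \<Gamma>"
    and mu: "\<mu> = sphere_inf K \<Gamma> ncl M"
    and Kloc: "fin_dim (UNIV :: 'l set)"
    and Gamma_loc: "subspace \<Gamma>loc"
    and Theta: "range \<Theta> \<subseteq> K"
    and Mloc: "\<forall>x. 0 \<le> Mloc x"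
    and Err: "\<forall>x. 0 \<le> Err x"
    and eps_delta: "0 \<le> \<epsilon>" "\<epsilon> < 1" "0 \<le> \<delta>"
    and transfer_dist:
      "\<forall>x. dist_to ncl \<Gamma> (\<Theta> x) \<ge> (1 - \<epsilon>) * infdist x \<Gamma>loc - \<delta>"
    and transfer_detector: "\<forall>x. Mloc x + Err x \<ge> M (\<Theta> x)"
    and eta_Delta: "0 \<le> \<eta>" "0 \<le> \<Delta>"
    and budget: "\<forall>x. Err x \<le> \<eta> * infdist x \<Gamma>loc + \<Delta>"
  shows "(\<forall>x. Mloc x \<ge> (\<mu> * (1 - \<epsilon>) - \<eta>) * infdist x \<Gamma>loc - \<mu> * \<delta> - \<Delta>) \<and>
    (\<eta> < \<mu> * (1 - \<epsilon>) \<longrightarrow>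
      0 < \<mu> * (1 - \<epsilon>) - \<eta> \<and>
      (\<forall>x. infdist x \<Gamma>loc \<le> (Mloc x + (\<mu> * \<delta> + \<Delta>)) / (\<mu> * (1 - \<epsilon>) - \<eta>)))"
proof -
  have \<Gamma>: "subspace \<Gamma>" "\<Gamma> \<subseteq> K"
    using K(1) linear_subspace_image[OF G(1) subspace_UNIV]
    by (auto simp: Gamma intro: subspace_inter)
  have \<Gamma>_fin: "fin_dim \<Gamma>"
    using fin_dim_range[OF G(1) C] by (auto simp: Gamma fin_dim_def)
  \<comment> \<open>Equality would leave \<open>\<Gamma>\<close> as the only class.\<close>
  have "K \<noteq> \<Gamma>" using quot_nontrivial quot_space_self[OF \<Gamma>(1)] by metis
  have nK: "norm_on K ncl" using ncl K(2) by (rule norm_on_subset)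
  have Obs_mem: "Obs d \<in> prod_space J E" if "d \<in> K" for d
    using Obs that by (auto simp: linear_on_def)
  have M_nonneg: "0 \<le> M d" if "d \<in> K" for d
    using nO Obs_mem[OF that] Tax_nonneg that C_pos
    by (auto simp: M Rep rep_size_def norm_on_def intro!: add_nonneg_nonneg mult_nonneg_nonneg sum_nonneg)
  have M_gauge: "gauge_invariant K \<Gamma> M"
    using gauge by (simp add: M gauge_invariant_def)
  have Rep_hom: "Rep (c *\<^sub>R d) = \<bar>c\<bar> * Rep d" if "d \<in> K" for c d
    unfolding Rep
    by (rule rep_size_scaleR[where D = D]) (use D R K(2) that in \<open>auto simp: fd_normed_space_def\<close>)
  have M_hom: "M (c *\<^sub>R d) = \<bar>c\<bar> * M d" if "d \<in> K" for c d
    using that Obs nO Obs_mem[OF that] Tax_hom Rep_hom[OF that]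
    by (simp add: M linear_on_def norm_on_def algebra_simps)
  note sphere = K(1) nK \<Gamma> M_gauge M_nonneg
  have \<mu>: "0 \<le> \<mu>"
    unfolding mu by (rule sphere_inf_nonneg[OF sphere \<Gamma>_fin \<open>K \<noteq> \<Gamma>\<close>])
  have bound: "Mloc x \<ge> (\<mu> * (1 - \<epsilon>) - \<eta>) * infdist x \<Gamma>loc - \<mu> * \<delta> - \<Delta>" for x
  proof -
    have "\<Theta> x \<in> K" using Theta by blast
    \<comment> \<open>Multiplication by \<open>\<mu> \<ge> 0\<close> preserves the transfer
      inequality, whatever the sign of its lower bound.\<close>
    have "\<mu> * ((1 - \<epsilon>) * infdist x \<Gamma>loc - \<delta>) \<le> \<mu> * dist_to ncl \<Gamma> (\<Theta> x)"
      using transfer_dist \<mu> by (intro mult_left_mono) auto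
    also have "\<dots> \<le> M (\<Theta> x)"
      unfolding mu by (rule sphere_inf_mult_dist_to_le[OF sphere M_hom \<open>\<Theta> x \<in> K\<close>])
    also have "\<dots> \<le> Mloc x + Err x" using transfer_detector by simp
    also have "\<dots> \<le> Mloc x + (\<eta> * infdist x \<Gamma>loc + \<Delta>)" using budget by simp
    finally show ?thesis by (simp add: algebra_simps)
  qed
  have "infdist x \<Gamma>loc \<le> (Mloc x + (\<mu> * \<delta> + \<Delta>)) / (\<mu> * (1 - \<epsilon>) - \<eta>)"
    if "\<eta> < \<mu> * (1 - \<epsilon>)" for x
    using that bound[of x] by (simp add: pos_le_divide_eq mult.commute)
  with bound show ?thesis by simp
qed

end
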